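(* For every $\omega\in\Omega\setminus\Omega_2$, the group $\tilde G_\omega$ is infinitely presented (i.e. not finitely presented).
   Context: $\Omega=\{0,1,2\}^{\mathbb{N}}$, with elements $\omega=\omega_1\omega_2\cdots$, and $\Omega_2\subset\Omega$ is the set of eventually constant sequences. Let $T_2$ be the rooted binary tree whose vertices are the finite words over $\{0,1\}$. Let $a\in \mathrm{Aut}(T_2)$ swap the two subtrees at the root ($0w\leftrightarrow 1w$). A sequence $(p_n)_{n\ge1}$ with $p_n\in\{P,I\}$ is identified with the automorphism that acts at each vertex $1^{n-1}0$ by swapping the two subtrees below it if $p_n=P$ and trivially if $p_n=I$, and acts trivially at all other vertices. Let $x=(P,P,P,\dots)$, and let $b_\omega,c_\omega,d_\omega$ be the automorphisms given by the sequences with $b_n=P$ iff $\omega_n\in\{0,1\}$, $c_n=P$ iff $\omega_n\in\{0,2\}$, $d_n=P$ iff $\omega_n\in\{1,2\}$. The generalized overgroup $\tilde G_\omega$ is the subgroup of $\mathrm{Aut}(T_2)$ generated by $a,b_\omega,c_\omega,d_\omega,x$ (equivalently by these together with $\tilde b_\omega=xb_\omega$, $\tilde c_\omega=xc_\omega$, $\tilde d_\omega=xd_\omega$). *)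

theory Defs
  imports "HOL-Algebra.Algebra"
begin

section \<open>Finitely presented groups\<close>

text \<open>The letter \<open>(s, True)\<close> is the generator \<open>s\<close>, and \<open>(s, False)\<close> is its formal inverse.\<close>

type_synonym 'a letter = "'a \<times> bool"

definition inv_letter :: "'a letter \<Rightarrow> 'a letter" where
  "inv_letter l = (fst l, \<not> snd l)"

definition reduced :: "'a letter list \<Rightarrow> bool" where
  "reduced w \<longleftrightarrow> successively (\<lambda>l m. m \<noteq> inv_letter l) w"

fun reduced_Cons :: "'a letter \<Rightarrow> 'a letter list \<Rightarrow> 'a letter list" where
  "reduced_Cons l [] = [l]"
| "reduced_Cons l (m # w) = (if m = inv_letter l then w else l # m # w)"

text \<open>If \<open>v\<close> is reduced, then \<open>foldr reduced_Cons u v\<close> is the reduced form of \<open>u @ v\<close>.\<close>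

definition free_group :: "'a set \<Rightarrow> 'a letter list monoid" where
  "free_group S =
     \<lparr>carrier = {w. reduced w \<and> fst ` set w \<subseteq> S}, monoid.mult = foldr reduced_Cons, one = []\<rparr>"

definition normal_closure :: "('a, 'b) monoid_scheme \<Rightarrow> 'a set \<Rightarrow> 'a set" where
  "normal_closure G R = \<Inter> {N. N \<lhd> G \<and> R \<subseteq> N}"

definition finitely_presented :: "('a, 'b) monoid_scheme \<Rightarrow> bool" where
  "finitely_presented G \<longleftrightarrow>
     (\<exists>(S :: nat set) R. finite S \<and> finite R \<and> R \<subseteq> carrier (free_group S) \<and>
        G \<cong> free_group S Mod normal_closure (free_group S) R)"

lemma inv_letter_inv_letter [simp]: "inv_letter (inv_letter l) = l"
  by (simp add: inv_letter_def)

lemma fst_inv_letter [simp]: "fst (inv_letter l) = fst l"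
  by (simp add: inv_letter_def)

lemma reduced_Nil [simp]: "reduced []"
  by (simp add: reduced_def)

lemma reduced_ConsD: "reduced (l # w) \<Longrightarrow> reduced w"
  by (cases w) (auto simp: reduced_def)

lemma reduced_reduced_Cons: "reduced w \<Longrightarrow> reduced (reduced_Cons l w)"
  by (cases w) (auto simp: reduced_def elim: successively.elims)

lemma reduced_foldr: "reduced v \<Longrightarrow> reduced (foldr reduced_Cons u v)"
  by (induction u) (auto intro: reduced_reduced_Cons)

lemma set_reduced_Cons: "set (reduced_Cons l w) \<subseteq> insert l (set w)"
  by (cases w) auto

lemma set_foldr: "set (foldr reduced_Cons u v) \<subseteq> set u \<union> set v"
  by (induction u) (use set_reduced_Cons in fastforce)+

lemma reduced_Cons_cancel:
  "reduced w \<Longrightarrow> reduced_Cons l (reduced_Cons (inv_letter l) w) = w"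
proof (cases w)
  case (Cons m w')
  assume "reduced w"
  then show ?thesis
    using Cons by (cases w') (auto simp: reduced_def)
qed simp

lemma foldr_reduced_Cons:
  assumes "reduced w"
  shows "foldr reduced_Cons (reduced_Cons l v) w = reduced_Cons l (foldr reduced_Cons v w)"
proof (cases v)
  case (Cons m v')
  show ?thesis
    using Cons reduced_Cons_cancel[OF reduced_foldr[OF assms], of l v'] by auto
qed simp

lemma foldr_assoc:
  assumes "reduced w"
  shows "foldr reduced_Cons (foldr reduced_Cons u v) w
       = foldr reduced_Cons u (foldr reduced_Cons v w)"
  by (induction u) (simp_all add: foldr_reduced_Cons assms)

lemma foldr_inverse: "reduced w \<Longrightarrow> foldr reduced_Cons (rev (map inv_letter w)) w = []"
proof (induction w)
  case (Cons l w)
  then show ?case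
    by (simp add: reduced_ConsD)
qed simp

lemma reduced_inverse: "reduced w \<Longrightarrow> reduced (rev (map inv_letter w))"
  by (auto simp: reduced_def successively_map inv_letter_def prod_eq_iff
      elim!: successively_mono[rotated] successively_mono)

lemma group_free_group: "group (free_group S)"
proof (rule groupI, goal_cases)
  case (1 u v)
  then show ?case
    using set_foldr[of u v] by (fastforce simp: free_group_def intro: reduced_foldr)
next
  case 2
  then show ?case by (simp add: free_group_def)
next
  case (3 u v w)
  then show ?case by (simp add: free_group_def foldr_assoc)
next
  case (4 w)
  then show ?case by (simp add: free_group_def)
next
  case (5 w)
  show ?case
  proof
    show "rev (map inv_letter w) \<in> carrier (free_group S)"
      using 5 by (auto simp: free_group_def reduced_inverse)
    show "rev (map inv_letter w) \<otimes>\<^bsub>free_group S\<^esub> w = \<one>\<^bsub>free_group S\<^esub>"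
      using 5 by (simp add: free_group_def foldr_inverse)
  qed
qed

lemma (in group) normal_closure_normal:
  assumes "R \<subseteq> carrier G"
  shows "normal_closure G R \<lhd> G"
proof -
  have car: "carrier G \<lhd> G"
    by (simp add: normal_inv_iff subgroup_self)
  have "subgroup (normal_closure G R) G"
    unfolding normal_closure_def using car assms
    by (intro subgroups_Inter) (auto dest: normal_imp_subgroup)
  then show ?thesis
    by (auto simp: normal_inv_iff normal_closure_def)
qed


section \<open>The rooted binary tree\<close>

text \<open>Words over \<open>{0, 1}\<close>, with \<open>False\<close> for \<open>0\<close> and \<open>True\<close> for \<open>1\<close>; the root is \<open>[]\<close>.\<close>

type_synonym vertex = "bool list"

definition adjacent :: "vertex \<Rightarrow> vertex \<Rightarrow> bool" where
  "adjacent u v \<longleftrightarrow> (\<exists>i. v = u @ [i] \<or> u = v @ [i])"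

definition tree_automorphisms :: "(vertex \<Rightarrow> vertex) set" where
  "tree_automorphisms =
     {f. bij f \<and> f [] = [] \<and> (\<forall>u v. adjacent (f u) (f v) \<longleftrightarrow> adjacent u v)}"

definition Aut_T2 :: "(vertex \<Rightarrow> vertex) monoid" where
  "Aut_T2 = (BijGroup UNIV)\<lparr>carrier := tree_automorphisms\<rparr>"

text \<open>\<open>swap_at V\<close> swaps the two subtrees below each vertex in \<open>V\<close> and acts trivially at
  every other vertex.\<close>

fun swap_at :: "vertex set \<Rightarrow> vertex \<Rightarrow> vertex" where
  "swap_at V [] = []"
| "swap_at V (i # w) = (if [] \<in> V then \<not> i else i) # swap_at {v. i # v \<in> V} w"


section \<open>Generalized overgroups\<close>

text \<open>Sequences are indexed from \<open>0\<close>: \<open>\<omega> n\<close> and \<open>p n\<close> are the entries number \<open>n + 1\<close>, and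
  entry \<open>n\<close> of \<open>p\<close> governs the vertex \<open>1\<dots>10\<close> with \<open>n\<close> ones. The symbol \<open>P\<close> is \<open>True\<close>, and
  the symbol \<open>I\<close> is \<open>False\<close>.\<close>

definition Omega :: "(nat \<Rightarrow> nat) set" where
  "Omega = {\<omega>. \<forall>n. \<omega> n \<in> {0, 1, 2}}"

definition Omega2 :: "(nat \<Rightarrow> nat) set" where
  "Omega2 = {\<omega> \<in> Omega. \<exists>c N. \<forall>n\<ge>N. \<omega> n = c}"

definition seq_aut :: "(nat \<Rightarrow> bool) \<Rightarrow> vertex \<Rightarrow> vertex" where
  "seq_aut p = swap_at {replicate n True @ [False] |n. p n}"

definition gen_a :: "vertex \<Rightarrow> vertex" where
  "gen_a = swap_at {[]}"

definition gen_x :: "vertex \<Rightarrow> vertex" where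
  "gen_x = seq_aut (\<lambda>n. True)"

definition gen_b :: "(nat \<Rightarrow> nat) \<Rightarrow> vertex \<Rightarrow> vertex" where
  "gen_b \<omega> = seq_aut (\<lambda>n. \<omega> n \<in> {0, 1})"

definition gen_c :: "(nat \<Rightarrow> nat) \<Rightarrow> vertex \<Rightarrow> vertex" where
  "gen_c \<omega> = seq_aut (\<lambda>n. \<omega> n \<in> {0, 2})"

definition gen_d :: "(nat \<Rightarrow> nat) \<Rightarrow> vertex \<Rightarrow> vertex" where
  "gen_d \<omega> = seq_aut (\<lambda>n. \<omega> n \<in> {1, 2})"

definition overgroup :: "(nat \<Rightarrow> nat) \<Rightarrow> (vertex \<Rightarrow> vertex) monoid" where
  "overgroup \<omega> =
     Aut_T2\<lparr>carrier := generate Aut_T2 {gen_a, gen_b \<omega>, gen_c \<omega>, gen_d \<omega>, gen_x}\<rparr>"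

lemma subgroup_tree_automorphisms: "subgroup tree_automorphisms (BijGroup UNIV)"
proof (rule group.subgroupI[OF group_BijGroup], goal_cases)
  case 1
  then show ?case by (auto simp: tree_automorphisms_def BijGroup_def Bij_def)
next
  case 2
  have "(\<lambda>v. v) \<in> tree_automorphisms"
    by (simp add: tree_automorphisms_def bij_id[unfolded id_def])
  then show ?case by blast
next
  case (3 f)
  then have f: "bij f" "f [] = []" "\<And>u v. adjacent (f u) (f v) \<longleftrightarrow> adjacent u v"
    by (auto simp: tree_automorphisms_def)
  have "adjacent (inv_into UNIV f u) (inv_into UNIV f v) \<longleftrightarrow> adjacent u v" for u v
    using f(3)[of "inv_into UNIV f u" "inv_into UNIV f v"] f(1)
    by (simp add: bij_is_surj surj_f_inv_f)
  moreover have "inv_into UNIV f [] = []"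
    using f(1,2) by (metis bij_is_inj inv_f_f)
  ultimately have "inv_into UNIV f \<in> tree_automorphisms"
    using f(1) by (simp add: tree_automorphisms_def bij_imp_bij_inv)
  moreover have "inv\<^bsub>BijGroup UNIV\<^esub> f = inv_into UNIV f"
    using f(1) by (subst inv_BijGroup) (auto simp: Bij_def)
  ultimately show ?case by simp
next
  case (4 f g)
  then have "f \<otimes>\<^bsub>BijGroup UNIV\<^esub> g = f \<circ> g"
    by (auto simp: tree_automorphisms_def BijGroup_def Bij_def compose_def)
  with 4 show ?case
    by (auto simp: tree_automorphisms_def bij_comp)
qed

lemma group_Aut_T2: "group Aut_T2"
  unfolding Aut_T2_def
  by (rule subgroup.subgroup_is_group[OF subgroup_tree_automorphisms group_BijGroup])

lemma length_swap_at [simp]: "length (swap_at V w) = length w"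
  by (induction V w rule: swap_at.induct) auto

lemma inj_swap_at: "swap_at V u = swap_at V v \<Longrightarrow> u = v"
proof (induction V u arbitrary: v rule: swap_at.induct)
  case (1 V)
  then show ?case by (cases v) auto
next
  case (2 V i w)
  then show ?case by (cases v) (auto split: if_splits)
qed

lemma surj_swap_at: "\<exists>u. swap_at V u = v"
proof (induction v arbitrary: V)
  case Nil
  show ?case by (rule exI[of _ "[]"]) simp
next
  case (Cons i v)
  let ?j = "if [] \<in> V then \<not> i else i"
  obtain u where "swap_at {w. ?j # w \<in> V} u = v"
    using Cons by blast
  then have "swap_at V (?j # u) = i # v" by simp
  then show ?case by blast
qed

lemma swap_at_snoc: "swap_at V (w @ [i]) = swap_at V w @ [if w \<in> V then \<not> i else i]"
  by (induction V w rule: swap_at.induct) auto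

lemma swap_at_tree_automorphism: "swap_at V \<in> tree_automorphisms"
proof -
  have child: "(\<exists>i. swap_at V v = swap_at V u @ [i]) \<longleftrightarrow> (\<exists>i. v = u @ [i])" for u v
  proof
    assume "\<exists>i. swap_at V v = swap_at V u @ [i]"
    then obtain i where "swap_at V v = swap_at V u @ [i]" ..
    then have "swap_at V v = swap_at V (u @ [if u \<in> V then \<not> i else i])"
      by (simp add: swap_at_snoc)
    then show "\<exists>i. v = u @ [i]" using inj_swap_at by blast
  qed (auto simp: swap_at_snoc)
  have "bij (swap_at V)"
    by (metis bijI' inj_swap_at surj_swap_at)
  then show ?thesis
    using child by (simp add: tree_automorphisms_def adjacent_def ex_disj_distrib)
qed

lemma group_overgroup: "group (overgroup \<omega>)"
proof -
  have "{gen_a, gen_b \<omega>, gen_c \<omega>, gen_d \<omega>, gen_x} \<subseteq> carrier Aut_T2"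
    by (simp add: Aut_T2_def gen_a_def gen_b_def gen_c_def gen_d_def gen_x_def seq_aut_def
        swap_at_tree_automorphism)
  then show ?thesis
    unfolding overgroup_def
    by (intro subgroup.subgroup_is_group group.generate_is_subgroup group_Aut_T2)
qed

end

(* The subgroup {1, b, c, d, x, xb, xc, xd} consists of the automorphisms beta_S, for S a set of
   symbols, that act at the vertex 1^(n-1)0 by P iff omega_n lies in S. Let E be a set of symbols
   that occur infinitely often in omega.

   Sections shorten words, so a relation of the group of omega is verified on finitely many
   levels: it also holds for every omega' that agrees with omega on a long prefix and takes only
   values in E where it differs from omega. If the group were finitely presented, then one length
   of the prefix would serve for all relations.

   To refute this, take distinct s, t in E. Under the substitution a -> axa that fixes every
   beta_S, a power of a commutator [beta_{s}, beta_{t}^g] becomes a word with trivial section at 0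
   and with the original word as its section at 1, whatever the first symbol is, since that symbol
   is outside {s} or outside {t}. So it suffices to find such a word that distinguishes sequences
   with an arbitrary common prefix. If the first symbol is s, then [beta_{s}, beta_{t}^a] has the
   sections (a beta_{t})^2 and 1. The order of a beta_{t} is finite, unless the sequence is
   constantly t, in which case it is infinite. *)

theory Submission
  imports Defs
begin

section \<open>Words in the generators, their action and their sections\<close>

definition shift :: "(nat \<Rightarrow> nat) \<Rightarrow> nat \<Rightarrow> nat" where
  "shift \<omega> n = \<omega> (Suc n)"

text \<open>Words in the generators: \<open>None\<close> is the letter \<open>a\<close>, and \<open>Some S\<close> is the sequence that has \<open>P\<close>
  at the positions where \<open>\<omega>\<close> takes a value in \<open>S\<close>.\<close>

fun gen :: "(nat \<Rightarrow> nat) \<Rightarrow> nat set option \<Rightarrow> vertex \<Rightarrow> vertex" where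
  "gen \<omega> None = gen_a"
| "gen \<omega> (Some S) = seq_aut (\<lambda>n. \<omega> n \<in> S)"

primrec act :: "(nat \<Rightarrow> nat) \<Rightarrow> nat set option list \<Rightarrow> vertex \<Rightarrow> vertex" where
  "act \<omega> [] = id"
| "act \<omega> (l # w) = gen \<omega> l \<circ> act \<omega> w"

primrec parity :: "nat set option list \<Rightarrow> bool \<Rightarrow> bool" where
  "parity [] i = i"
| "parity (l # w) i = (if l = None then \<not> parity w i else parity w i)"

text \<open>\<open>sec c w i\<close> is the section of \<open>w\<close> at the vertex \<open>i\<close> if \<open>c\<close> is the first symbol of \<open>\<omega>\<close>. It is
  a word for the shifted sequence.\<close>

primrec sec :: "nat \<Rightarrow> nat set option list \<Rightarrow> bool \<Rightarrow> nat set option list" where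
  "sec c [] i = []"
| "sec c (l # w) i =
     (case l of None \<Rightarrow> []
      | Some S \<Rightarrow> if parity w i then [Some S] else if c \<in> S then [None] else []) @ sec c w i"

lemma swap_at_empty [simp]: "swap_at {} v = v"
  by (induction v) auto

lemma gen_a_Nil [simp]: "gen_a [] = []"
  and gen_a_Cons [simp]: "gen_a (i # v) = (\<not> i) # v"
  by (simp_all add: gen_a_def)

lemma seq_aut_Nil [simp]: "seq_aut p [] = []"
  by (simp add: seq_aut_def)

lemma seq_aut_Cons [simp]:
  "seq_aut p (i # v) =
     i # (if i then seq_aut (\<lambda>n. p (Suc n)) v else if p 0 then gen_a v else v)"
proof (cases i)
  case True
  have "{v. True # v \<in> {replicate n True @ [False] |n. p n}}
      = {replicate n True @ [False] |n. p (Suc n)}"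
  proof (intro Set.set_eqI iffI)
    fix v assume "v \<in> {v. True # v \<in> {replicate n True @ [False] |n. p n}}"
    then obtain n where "True # v = replicate n True @ [False]" "p n" by auto
    then show "v \<in> {replicate n True @ [False] |n. p (Suc n)}" by (cases n) auto
  next
    fix v assume "v \<in> {replicate n True @ [False] |n. p (Suc n)}"
    then obtain n where "v = replicate n True @ [False]" "p (Suc n)" by auto
    then show "v \<in> {v. True # v \<in> {replicate n True @ [False] |n. p n}}"
      by (auto intro!: exI[of _ "Suc n"])
  qed
  then show ?thesis using True by (auto simp: seq_aut_def)
next
  case False
  have "False # v = replicate n True @ [False] \<longleftrightarrow> n = 0 \<and> v = []" for n v
    by (cases n) auto
  then have "{v. False # v \<in> {replicate n True @ [False] |n. p n}} = (if p 0 then {[]} else {})"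
    by auto
  then show ?thesis using False by (auto simp: seq_aut_def gen_a_def)
qed

lemma gen_a_gen_a [simp]: "gen_a (gen_a v) = v"
  by (cases v) auto

lemma seq_aut_seq_aut: "seq_aut p (seq_aut q v) = seq_aut (\<lambda>n. p n \<noteq> q n) v"
  by (induction v arbitrary: p q) auto

lemma seq_aut_False [simp]: "seq_aut (\<lambda>n. False) v = v"
  by (induction v) auto

lemma seq_aut_eq_id: "seq_aut p = id \<longleftrightarrow> (\<forall>n. \<not> p n)"
proof
  assume "seq_aut p = id"
  then have id: "seq_aut p v = v" for v by simp
  \<comment> \<open>The vertex \<open>1^n 0 0\<close> is a probe for entry \<open>n\<close>: the
    only vertex on its path that can carry a swap is \<open>1^n 0\<close>.\<close>
  have "p n \<Longrightarrow> seq_aut p (replicate n True @ [False, False]) = replicate n True @ [False, True]" for n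
    by (induction n arbitrary: p) auto
  then show "\<forall>n. \<not> p n" using id by fastforce
next
  assume "\<forall>n. \<not> p n"
  then have "p = (\<lambda>n. False)" by auto
  then show "seq_aut p = id" by (simp only:) (simp add: fun_eq_iff)
qed

lemma gen_gen [simp]: "gen \<omega> l (gen \<omega> l v) = v"
  by (cases l) (auto simp: seq_aut_seq_aut)

lemma gen_tree_automorphism: "gen \<omega> l \<in> tree_automorphisms"
  by (cases l) (auto simp: gen_a_def seq_aut_def swap_at_tree_automorphism)

lemma act_append [simp]: "act \<omega> (u @ v) = act \<omega> u \<circ> act \<omega> v"
  by (induction u) auto

lemma act_rev: "act \<omega> (rev w) (act \<omega> w v) = v"
  by (induction w arbitrary: v) auto

lemma act_rev_comp: "act \<omega> (rev w) \<circ> act \<omega> w = id"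
  by (auto simp: act_rev)

lemma act_comp_rev: "act \<omega> w \<circ> act \<omega> (rev w) = id"
  using act_rev_comp[of \<omega> "rev w"] by simp

lemma act_rev_eq_id: "act \<omega> w = id \<Longrightarrow> act \<omega> (rev w) = id"
  using act_rev_comp[of \<omega> w] by simp

lemma act_Nil_vertex [simp]: "act \<omega> w [] = []"
proof (induction w)
  case (Cons l w)
  then show ?case by (cases l) auto
qed simp

lemma act_Cons_vertex:
  "act \<omega> w (i # v) = parity w i # act (shift \<omega>) (sec (\<omega> 0) w i) v"
proof (induction w)
  case (Cons l w)
  then show ?case by (cases l) (auto simp: shift_def)
qed simp

text \<open>This recursion drives the inductions below: a word is exchanged for its two sections,
  and the sequence for its shift.\<close>

lemma act_eq_id_iff:
  "act \<omega> w = id \<longleftrightarrow> (\<forall>i. parity w i = i \<and> act (shift \<omega>) (sec (\<omega> 0) w i) = id)"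
proof
  assume "act \<omega> w = id"
  then have "act \<omega> w (i # v) = i # v" for i v by simp
  then show "\<forall>i. parity w i = i \<and> act (shift \<omega>) (sec (\<omega> 0) w i) = id"
    by (auto simp: act_Cons_vertex fun_eq_iff)
next
  assume *: "\<forall>i. parity w i = i \<and> act (shift \<omega>) (sec (\<omega> 0) w i) = id"
  have "act \<omega> w v = v" for v
    using * by (cases v) (auto simp: act_Cons_vertex)
  then show "act \<omega> w = id" by auto
qed

lemma parity_append [simp]: "parity (u @ v) i = parity u (parity v i)"
  by (induction u) auto

lemma sec_append [simp]: "sec c (u @ v) i = sec c u (parity v i) @ sec c v i"
  by (induction u) (auto split: option.splits)

section \<open>Contraction, and relations that survive a change of the sequence\<close>

definition alternating :: "nat set option list \<Rightarrow> bool" where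
  "alternating = successively (\<lambda>l m. (l = None) \<noteq> (m = None))"

text \<open>Two neighbours of the same kind multiply to at most one letter, so a word that fails to
  alternate can be shortened on the spot, without passing to sections.\<close>

lemma not_alternatingD:
  assumes "\<not> alternating w"
  obtains u l m v where "w = u @ l # m # v" "(l = None) = (m = None)"
proof -
  have "\<exists>u l m v. w = u @ l # m # v \<and> (l = None) = (m = None)"
    using assms
  proof (induction w)
    case (Cons l w)
    show ?case
    proof (cases w)
      case Nil
      with Cons.prems show ?thesis by (simp add: alternating_def)
    next
      case w: (Cons m v)
      show ?thesis
      proof (cases "(l = None) = (m = None)")
        case True
        then show ?thesis using w by (intro exI[of _ "[]"]) auto
      next
        case False
        then have "\<not> alternating w" using Cons.prems w by (simp add: alternating_def)
        then obtain u l' m' v' where "w = u @ l' # m' # v' \<and> (l' = None) = (m' = None)"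
          using Cons.IH by blast
        then show ?thesis by (intro exI[of _ "l # u"]) auto
      qed
    qed
  qed (simp add: alternating_def)
  then show thesis using that by blast
qed

text \<open>The summand for a leading sequence letter is what lets the induction over the first
  letter close.\<close>

lemma alternating_count:
  "alternating w \<Longrightarrow>
     2 * length (filter (\<lambda>l. l \<noteq> None) w) \<le> length w + (if w \<noteq> [] \<and> hd w \<noteq> None then 1 else 0)"
proof (induction w)
  case (Cons l w)
  then show ?case
    by (cases w) (auto simp: alternating_def split: if_splits)
qed simp

lemma length_sec: "length (sec c w i) \<le> length (filter (\<lambda>l. l \<noteq> None) w)"
  by (induction w) (auto split: option.splits)

text \<open>Only sequence letters contribute to a section, at most one letter each, and they make up
  at most half of an alternating word, rounded up. From length 2 on this is a strict
  decrease.\<close>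

lemma length_sec_less:
  assumes "alternating w" "2 \<le> length w"
  shows "length (sec c w i) < length w"
  using length_sec[of c w i] alternating_count[OF assms(1)] assms(2) by (auto split: if_splits)

text \<open>The first conjunct constrains all positions: a letter \<open>Some S\<close> that is
  trivial for \<open>\<omega>\<close> should stay trivial for \<open>\<omega>'\<close>, so no value
  may appear that is neither the old one nor in \<open>E\<close>.\<close>

definition close :: "nat set \<Rightarrow> nat \<Rightarrow> (nat \<Rightarrow> nat) \<Rightarrow> (nat \<Rightarrow> nat) \<Rightarrow> bool" where
  "close E n \<omega> \<omega>' \<longleftrightarrow> (\<forall>k. \<omega>' k = \<omega> k \<or> \<omega>' k \<in> E) \<and> (\<forall>k<n. \<omega>' k = \<omega> k)"

lemma close_mono: "close E n \<omega> \<omega>' \<Longrightarrow> m \<le> n \<Longrightarrow> close E m \<omega> \<omega>'"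
  by (auto simp: close_def)

lemma close_shift: "close E (Suc n) \<omega> \<omega>' \<Longrightarrow> close E n (shift \<omega>) (shift \<omega>')"
  by (auto simp: close_def shift_def)

text \<open>Induction on the length of the word: either two neighbours merge, or both sections are
  shorter. The recurrence of the values in \<open>E\<close> is inherited by every shift, so the
  induction hypothesis applies to the sections.\<close>

lemma relation_stable:
  assumes "\<And>e k. e \<in> E \<Longrightarrow> \<exists>j\<ge>k. \<omega> j = e" and "act \<omega> w = id"
  shows "\<exists>n. \<forall>\<omega>'. close E n \<omega> \<omega>' \<longrightarrow> act \<omega>' w = id"
  using assms
proof (induction w arbitrary: \<omega> rule: length_induct)
  case (1 w)
  note inf = 1(2) and triv = 1(3)
  have IH: "\<exists>n. \<forall>\<omega>'. close E n \<omega> \<omega>' \<longrightarrow> act \<omega>' u = id"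
    if "length u < length w" "\<And>e k. e \<in> E \<Longrightarrow> \<exists>j\<ge>k. \<omega> j = e" "act \<omega> u = id" for u \<omega>
    using 1(1) that by blast
  consider (short) "length w \<le> 1" | (cancel) "\<not> alternating w"
    | (long) "alternating w" "2 \<le> length w" by linarith
  then show ?case
  proof cases
    case short
    then consider "w = []" | "w = [None]" | S where "w = [Some S]"
      by (cases w) (auto simp: le_Suc_eq)
    then show ?thesis
    proof cases
      case 1
      then show ?thesis by simp
    next
      case 2
      then have "gen_a [True] = [True]" using triv by simp
      then show ?thesis by simp
    next
      case (3 S)
      then have S: "\<omega> n \<notin> S" for n using triv by (simp add: seq_aut_eq_id[unfolded id_def])
      have "act \<omega>' w = id" if "close E n \<omega> \<omega>'" for \<omega>' n
      proof -
        \<comment> \<open>Every value of \<open>\<omega>'\<close> is a value of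
          \<open>\<omega>\<close>, because the elements of \<open>E\<close> occur in
          \<open>\<omega>\<close>.\<close>
        have "\<omega>' k \<notin> S" for k
          using that S inf unfolding close_def by metis
        then show ?thesis using 3 by (simp add: seq_aut_eq_id)
      qed
      then show ?thesis by blast
    qed
  next
    case cancel
    then obtain u l m v where w: "w = u @ l # m # v" "(l = None) = (m = None)"
      by (rule not_alternatingD)
    \<comment> \<open>Two letters \<open>a\<close> cancel, and two sequences multiply to the
      sequence of the symmetric difference, whatever \<open>\<omega>\<close> is.\<close>
    obtain y where y: "length y \<le> 1" "\<And>\<omega>. act \<omega> y = gen \<omega> l \<circ> gen \<omega> m"
    proof (cases "l = None")
      case True
      then show ?thesis using w(2) by (intro that[of "[]"]) (auto simp: fun_eq_iff)
    next
      case False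
      then obtain S T where "l = Some S" "m = Some T" using w(2) by auto
      then show ?thesis
        by (intro that[of "[Some {k. (k \<in> S) \<noteq> (k \<in> T)}]"]) (auto simp: seq_aut_seq_aut)
    qed
    have eq: "act \<omega> (u @ y @ v) = act \<omega> w" for \<omega>
      using w(1) y(2) by (simp add: comp_assoc)
    have "length (u @ y @ v) < length w" using w(1) y(1) by simp
    moreover have "act \<omega> (u @ y @ v) = id" unfolding eq by (rule triv)
    ultimately have "\<exists>n. \<forall>\<omega>'. close E n \<omega> \<omega>' \<longrightarrow> act \<omega>' (u @ y @ v) = id"
      using IH inf by blast
    then show ?thesis by (simp only: eq)
  next
    case long
    have inf': "\<exists>j\<ge>k. shift \<omega> j = e" if e: "e \<in> E" for e k
    proof -
      obtain j where "j \<ge> Suc k" "\<omega> j = e" using inf[OF e] by blast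
      then show ?thesis by (intro exI[of _ "j - 1"]) (auto simp: shift_def)
    qed
    have "\<exists>n. \<forall>\<omega>'. close E n (shift \<omega>) \<omega>' \<longrightarrow> act \<omega>' (sec (\<omega> 0) w i) = id" for i
      using iffD1[OF act_eq_id_iff triv] by (intro IH inf' length_sec_less long) blast+
    then obtain n where
      n: "\<And>i \<omega>'. close E (n i) (shift \<omega>) \<omega>' \<Longrightarrow> act \<omega>' (sec (\<omega> 0) w i) = id"
      by metis
    \<comment> \<open>One more level than the sections require: agreement at position 0 ensures that
      \<open>w\<close> has the same sections for both sequences.\<close>
    have "act \<omega>' w = id" if c: "close E (Suc (max (n True) (n False))) \<omega> \<omega>'" for \<omega>'
    proof -
      have "close E (n i) (shift \<omega>) (shift \<omega>')" for i
        using close_shift[OF c] by (rule close_mono) (cases i, auto)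
      moreover have "\<omega>' 0 = \<omega> 0" using c by (auto simp: close_def)
      moreover have "parity w i = i" for i
        using iffD1[OF act_eq_id_iff triv] by blast
      ultimately show ?thesis
        using n unfolding act_eq_id_iff[of \<omega>'] by metis
    qed
    then show ?thesis by blast
  qed
qed

section \<open>Lifted commutators, which ignore a prefix of the sequence\<close>

definition lift_word :: "nat set option list \<Rightarrow> nat set option list" where
  "lift_word w = concat (map (\<lambda>l. if l = None then [None, Some {0, 1, 2}, None] else [l]) w)"

text \<open>The section of \<open>lift_word w\<close> at the vertex \<open>0\<close>.\<close>

definition cosec :: "nat \<Rightarrow> nat set option list \<Rightarrow> nat set option list" where
  "cosec c w = concat (map (\<lambda>l. case l of None \<Rightarrow> [Some {0, 1, 2}]
     | Some S \<Rightarrow> if c \<in> S then [None] else []) w)"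

lemma rev_concat_map:
  "(\<And>l. rev (f l) = f l) \<Longrightarrow> rev (concat (map f w)) = concat (map f (rev w))"
  by (induction w) auto

lemma rev_lift_word: "rev (lift_word w) = lift_word (rev w)"
  unfolding lift_word_def by (rule rev_concat_map) auto

lemma rev_cosec: "rev (cosec c w) = cosec c (rev w)"
  unfolding cosec_def by (rule rev_concat_map) (auto split: option.splits)

lemma lift_word_simps [simp]:
  "lift_word [] = []" "lift_word (u @ v) = lift_word u @ lift_word v"
  "lift_word (None # w) = None # Some {0, 1, 2} # None # lift_word w"
  "lift_word (Some S # w) = Some S # lift_word w"
  by (simp_all add: lift_word_def)

lemma cosec_simps [simp]:
  "cosec c [] = []" "cosec c (u @ v) = cosec c u @ cosec c v"
  "cosec c (None # w) = Some {0, 1, 2} # cosec c w"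
  "cosec c (Some S # w) = (if c \<in> S then None # cosec c w else cosec c w)"
  by (simp_all add: cosec_def del: One_nat_def)

lemma parity_lift_word [simp]: "parity (lift_word w) i = i"
proof (induction w)
  case (Cons l w)
  then show ?case by (cases l) auto
qed simp

text \<open>The word \<open>axa\<close> fixes the first level; its sections are \<open>a\<close> at
  1 and \<open>x\<close> at 0. The section \<open>a\<close> arises because \<open>x\<close> swaps
  for each of the three symbols, whence the assumption on \<open>c\<close>.\<close>

lemma sec_lift_word:
  assumes "c \<in> {0, 1, 2}"
  shows "sec c (lift_word w) True = w" "sec c (lift_word w) False = cosec c w"
proof (induction w)
  case (Cons l w)
  {
    case 1
    then show ?case using Cons assms by (cases l) auto
  next
    case 2
    then show ?case using Cons assms by (cases l) auto
  }
qed simp_all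

lemma act_replicate_id: "act \<omega> w = id \<Longrightarrow> act \<omega> (concat (replicate N w)) = id"
  by (induction N) auto

text \<open>The \<open>N\<close>-th power of the commutator of the sequences of \<open>{s}\<close>
  and \<open>{t}\<close>, the latter conjugated by \<open>g\<close>. Both entries of the commutator
  are involutions and \<open>rev g\<close> inverts \<open>g\<close>, so no formal inverses
  occur.\<close>

definition comm_power :: "nat \<Rightarrow> nat \<Rightarrow> nat \<Rightarrow> nat set option list \<Rightarrow> nat set option list" where
  "comm_power N s t g =
     (let h = g @ [Some {t}] @ rev g in concat (replicate N ([Some {s}] @ h @ [Some {s}] @ h)))"

lemma lift_word_concat_replicate:
  "lift_word (concat (replicate N w)) = concat (replicate N (lift_word w))"
  by (induction N) auto

lemma cosec_concat_replicate:
  "cosec c (concat (replicate N w)) = concat (replicate N (cosec c w))"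
  by (induction N) auto

lemma lift_word_comm_power: "lift_word (comm_power N s t g) = comm_power N s t (lift_word g)"
  by (simp add: comm_power_def Let_def lift_word_concat_replicate rev_lift_word)

text \<open>If \<open>c\<close> differs from \<open>s\<close>, the letter \<open>Some {s}\<close>
  vanishes and the square of the involution \<open>h\<close> remains. If \<open>c = s\<close>, then
  \<open>Some {t}\<close> vanishes, \<open>h\<close> collapses to a word times its inverse, and the
  two letters \<open>a\<close> cancel.\<close>

lemma act_cosec_comm_power:
  assumes "s \<noteq> t"
  shows "act \<omega> (cosec c (comm_power N s t g)) = id"
proof -
  define h where "h = cosec c (g @ [Some {t}] @ rev g)"
  have "rev h = h"
    unfolding h_def rev_cosec by simp
  then have hh: "act \<omega> h \<circ> act \<omega> h = id"
    using act_rev_comp[of \<omega> h] by simp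
  have id: "act \<omega> h = id" if "c = s"
    using that assms unfolding h_def by (auto simp flip: rev_cosec simp: act_comp_rev)
  have "act \<omega> (cosec c ([Some {s}] @ (g @ [Some {t}] @ rev g) @ [Some {s}] @ (g @ [Some {t}] @ rev g))) = id"
    unfolding cosec_simps(2)[of _ "[Some {s}]"] cosec_simps(2)[of _ "g @ [Some {t}] @ rev g"]
      h_def[symmetric]
    using hh id by (auto simp: fun_eq_iff)
  then show ?thesis
    unfolding comm_power_def Let_def cosec_concat_replicate by (rule act_replicate_id)
qed

lemma act_lift_comm_power:
  assumes "s \<noteq> t" "\<omega> 0 \<in> {0, 1, 2}"
  shows "act \<omega> (comm_power N s t (lift_word g)) = id \<longleftrightarrow> act (shift \<omega>) (comm_power N s t g) = id"
  unfolding act_eq_id_iff[of \<omega>] lift_word_comm_power[symmetric] all_bool_eq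
  using act_cosec_comm_power[OF assms(1)] assms(2) by (simp add: sec_lift_word)

text \<open>After \<open>m\<close> lifts the first \<open>m\<close> symbols have no influence, so a
  word that tells two sequences apart yields one that tells them apart behind a common
  prefix.\<close>

lemma act_lift_comm_power_funpow:
  assumes "s \<noteq> t" "\<omega> \<in> Omega"
  shows "act \<omega> (comm_power N s t ((lift_word ^^ m) g)) = id
     \<longleftrightarrow> act ((shift ^^ m) \<omega>) (comm_power N s t g) = id"
  using assms(2)
proof (induction m arbitrary: \<omega>)
  case (Suc m)
  have "shift \<omega> \<in> Omega" "\<omega> 0 \<in> {0, 1, 2}" using Suc.prems by (auto simp: Omega_def shift_def)
  then show ?case
    using Suc.IH[of "shift \<omega>"] act_lift_comm_power[OF assms(1), of \<omega> N "(lift_word ^^ m) g"]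
    by (simp add: funpow_swap1[of shift] id_def)
qed simp

section \<open>The order of the product of \<open>a\<close> and the sequence of
  \<open>{t}\<close>\<close>

definition dih :: "nat \<Rightarrow> nat \<Rightarrow> nat set option list" where
  "dih t k = concat (replicate k [None, Some {t}])"

lemma dih_Suc [simp]: "dih t 0 = []" "dih t (Suc k) = None # Some {t} # dih t k"
  by (simp_all add: dih_def)

lemma dih_add: "dih t (j + k) = dih t j @ dih t k"
  by (induction j) auto

lemma parity_dih [simp]: "parity (dih t k) i = (if even k then i else \<not> i)"
  by (induction k) auto

text \<open>If the first symbol is \<open>t\<close>, an even power of the product has half that
  power as its section at 1 and, by \<open>rev_dih\<close>, the inverse of that half at 0.\<close>

lemma sec_dih_same:
  "sec t (dih t (2 * k)) True = dih t k"
  "sec t (dih t (2 * k)) False = concat (replicate k [Some {t}, None])"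
  by (induction k) auto

lemma rev_dih: "rev (dih t k) = concat (replicate k [Some {t}, None])"
proof (induction k)
  case (Suc k)
  have "concat (replicate k [Some {t}, None]) @ [Some {t}, None] = concat (replicate (Suc k) [Some {t}, None])"
    by (induction k) auto
  with Suc show ?case by simp
qed simp

text \<open>Here the square already has the involution \<open>Some {t}\<close> as its section at
  both vertices.\<close>

lemma dih_order_4:
  assumes "\<tau> 0 \<noteq> t"
  shows "act \<tau> (dih t 4) = id"
  using assms unfolding act_eq_id_iff[of \<tau>] by (auto simp: numeral_eq_Suc seq_aut_seq_aut)

text \<open>Each leading \<open>t\<close> doubles the exponent, until a symbol other than
  \<open>t\<close> is met and the exponent 4 suffices.\<close>

lemma dih_finite_order:
  assumes "\<tau> k \<noteq> t"
  shows "\<exists>N>0. act \<tau> (dih t N) = id"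
  using assms
proof (induction k arbitrary: \<tau>)
  case 0
  then show ?case by (intro exI[of _ 4]) (simp add: dih_order_4)
next
  case (Suc k)
  show ?case
  proof (cases "\<tau> 0 = t")
    case False
    then show ?thesis by (intro exI[of _ 4]) (simp add: dih_order_4)
  next
    case True
    have "shift \<tau> k \<noteq> t" using Suc.prems by (simp add: shift_def)
    then obtain N where N: "N > 0" "act (shift \<tau>) (dih t N) = id"
      using Suc.IH by blast
    have "act \<tau> (dih t (2 * N)) = id"
      using N(2) act_rev_eq_id[OF N(2)] True
      unfolding act_eq_id_iff[of \<tau>] all_bool_eq by (simp add: sec_dih_same rev_dih)
    then show ?thesis using N(1) by (intro exI[of _ "2 * N"]) simp
  qed
qed

text \<open>Descent: a trivial power has even exponent, since odd powers move the first level, and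
  its section at 1 is trivial with half the exponent for the same constant sequence.\<close>

lemma dih_infinite_order: "act (\<lambda>_. t) (dih t N) = id \<Longrightarrow> N = 0"
proof (induction N rule: less_induct)
  case (less N)
  have "even N" using less.prems unfolding act_eq_id_iff[of "\<lambda>_. t"] by (auto split: if_splits)
  then obtain k where k: "N = 2 * k" by auto
  have "shift (\<lambda>_. t) = (\<lambda>_. t)" by (auto simp: shift_def)
  then have "act (\<lambda>_. t) (dih t k) = id"
    using less.prems k unfolding act_eq_id_iff[of "\<lambda>_. t" "dih t N"] by (simp add: all_bool_eq sec_dih_same)
  then show ?case using less.IH[of k] k by (cases "k = 0") auto
qed

text \<open>Conjugation by \<open>a\<close> interchanges the sections of \<open>Some {t}\<close>. So
  the letters of both kinds meet at 0, while at 1 only squares of \<open>Some {s}\<close> are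
  left.\<close>

lemma act_comm_power_a:
  assumes "s \<noteq> t" "\<tau> 0 = s"
  shows "act \<tau> (comm_power N s t [None]) = id \<longleftrightarrow> act (shift \<tau>) (dih t (2 * N)) = id"
proof -
  let ?u = "[Some {s}, None, Some {t}, None, Some {s}, None, Some {t}, None]"
  have u: "comm_power N s t [None] = concat (replicate N ?u)" for N
    by (simp add: comm_power_def)
  have par: "parity (concat (replicate N ?u)) i = i" for i N
    by (induction N) auto
  have sec_False: "sec s (concat (replicate N ?u)) False = dih t (2 * N)"
    using assms(1) by (induction N) (auto simp: par)
  have sec_True: "sec s (concat (replicate N ?u)) True = concat (replicate N [Some {s}, Some {s}])"
    using assms(1) by (induction N) (auto simp: par)
  have "act (shift \<tau>) (concat (replicate N [Some {s}, Some {s}])) = id"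
    by (rule act_replicate_id) (auto simp: seq_aut_seq_aut)
  then show ?thesis
    using assms(2) unfolding act_eq_id_iff[of \<tau>] all_bool_eq u par
    by (simp add: par sec_True sec_False)
qed


section \<open>Normal closures, and the overgroup as the set of values of words\<close>

lemma normal_closure_minimal: "N \<lhd> G \<Longrightarrow> R \<subseteq> N \<Longrightarrow> normal_closure G R \<subseteq> N"
  by (auto simp: normal_closure_def)

lemma subset_normal_closure: "R \<subseteq> normal_closure G R"
  by (auto simp: normal_closure_def)

lemma mult_Aut_T2:
  "f \<in> tree_automorphisms \<Longrightarrow> g \<in> tree_automorphisms \<Longrightarrow> f \<otimes>\<^bsub>Aut_T2\<^esub> g = f \<circ> g"
  by (auto simp: Aut_T2_def tree_automorphisms_def BijGroup_def Bij_def compose_def)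

lemma one_Aut_T2: "\<one>\<^bsub>Aut_T2\<^esub> = id"
  by (auto simp: Aut_T2_def BijGroup_def)

lemma carrier_Aut_T2: "carrier Aut_T2 = tree_automorphisms"
  by (simp add: Aut_T2_def)

lemma act_tree_automorphism: "act \<omega> w \<in> tree_automorphisms"
proof (induction w)
  case Nil
  then show ?case
    using monoid.one_closed[OF group.is_monoid[OF group_Aut_T2]]
    by (simp add: one_Aut_T2 carrier_Aut_T2 id_def)
next
  case (Cons l w)
  then show ?case
    using monoid.m_closed[OF group.is_monoid[OF group_Aut_T2], of "gen \<omega> l" "act \<omega> w"]
      gen_tree_automorphism[of \<omega> l]
    by (simp add: mult_Aut_T2 carrier_Aut_T2 comp_def)
qed

text \<open>Subsets of \<open>{0, 1, 2}\<close> suffice for sequences in \<open>Omega\<close> and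
  keep the alphabet finite, hence also the list of relations in
  \<open>finitely_presented_stable\<close>.\<close>

definition letters :: "nat set option set" where
  "letters = insert None (Some ` Pow {0, 1, 2})"

lemma finite_letters: "finite letters"
  by (simp add: letters_def)

abbreviation generators :: "(nat \<Rightarrow> nat) \<Rightarrow> (vertex \<Rightarrow> vertex) set" where
  "generators \<omega> \<equiv> {gen_a, gen_b \<omega>, gen_c \<omega>, gen_d \<omega>, gen_x}"

lemma generators_gen:
  assumes "\<omega> \<in> Omega"
  shows "generators \<omega> =
     gen \<omega> ` {None, Some {0, 1}, Some {0, 2}, Some {1, 2}, Some {0, 1, 2}}"
proof -
  have "gen_x = gen \<omega> (Some {0, 1, 2})"
    using assms by (simp add: gen_x_def Omega_def)
  then show ?thesis
    by (simp add: gen_b_def gen_c_def gen_d_def)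
qed

lemma generators_inv:
  assumes "\<omega> \<in> Omega" "f \<in> generators \<omega>"
  shows "inv\<^bsub>Aut_T2\<^esub> f = f"
proof -
  obtain l where l: "f = gen \<omega> l" using assms generators_gen by blast
  have "gen \<omega> l \<circ> gen \<omega> l = id" by auto
  then show ?thesis
    unfolding l
    by (intro group.inv_equality[OF group_Aut_T2])
      (simp_all add: mult_Aut_T2 gen_tree_automorphism carrier_Aut_T2 one_Aut_T2)
qed

lemma generate_subset:
  assumes "\<omega> \<in> Omega" "f \<in> generate Aut_T2 (generators \<omega>)"
  shows "f \<in> act \<omega> ` lists letters"
proof -
  have gen: "f \<in> act \<omega> ` lists letters" if f: "f \<in> generators \<omega>" for f
  proof -
    obtain l where l: "f = gen \<omega> l"
        "l \<in> {None, Some {0, 1}, Some {0, 2}, Some {1, 2}, Some {0, 1, 2}}"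
      using f unfolding generators_gen[OF assms(1)] by (rule imageE)
    then have "l \<in> letters" by (auto simp: letters_def)
    then show ?thesis using l(1) by (intro image_eqI[of _ _ "[l]"]) auto
  qed
  show ?thesis
    using assms(2)
  proof (induction rule: generate.induct)
    case one
    then show ?case by (intro image_eqI[of _ _ "[]"]) (auto simp: one_Aut_T2)
  next
    case (incl f)
    then show ?case by (rule gen)
  next
    case (inv f)
    then show ?case using gen generators_inv[OF assms(1)] by metis
  next
    case (eng f g)
    then obtain u v where "f = act \<omega> u" "g = act \<omega> v" "u \<in> lists letters" "v \<in> lists letters"
      by blast
    then show ?case
      by (intro image_eqI[of _ _ "u @ v"]) (auto simp: mult_Aut_T2 act_tree_automorphism)
  qed
qed

lemma xor_generate:
  assumes "gen \<omega> (Some S) \<in> generate Aut_T2 H" "gen \<omega> (Some T) \<in> generate Aut_T2 H"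
    and "U = S - T \<union> (T - S)"
  shows "gen \<omega> (Some U) \<in> generate Aut_T2 H"
proof -
  have "gen \<omega> (Some U) = gen \<omega> (Some S) \<circ> gen \<omega> (Some T)"
    using assms(3) by (auto simp: fun_eq_iff seq_aut_seq_aut intro!: arg_cong2[of _ _ _ _ seq_aut])
  also have "\<dots> = gen \<omega> (Some S) \<otimes>\<^bsub>Aut_T2\<^esub> gen \<omega> (Some T)"
    by (simp only: mult_Aut_T2 gen_tree_automorphism)
  also have "\<dots> \<in> generate Aut_T2 H"
    using assms by (intro generate.eng)
  finally show ?thesis .
qed

text \<open>The singletons come from products with \<open>x\<close>: the sequences of
  \<open>{0}\<close>, \<open>{1}\<close> and \<open>{2}\<close> are \<open>xd\<close>,
  \<open>xc\<close> and \<open>xb\<close>.\<close>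

lemma gen_in_generate:
  assumes "\<omega> \<in> Omega" "l \<in> letters"
  shows "gen \<omega> l \<in> generate Aut_T2 (generators \<omega>)"
proof (cases l)
  case None
  then show ?thesis by (auto intro: generate.incl)
next
  case (Some S)
  let ?G = "generate Aut_T2 (generators \<omega>)"
  have incl: "gen \<omega> l \<in> ?G" if "l \<in> {None, Some {0, 1}, Some {0, 2}, Some {1, 2}, Some {0, 1, 2}}" for l
    using that unfolding generators_gen[OF assms(1)] by (intro generate.incl imageI)
  have b: "gen \<omega> (Some {0, 1}) \<in> ?G" and c: "gen \<omega> (Some {0, 2}) \<in> ?G"
    and d: "gen \<omega> (Some {1, 2}) \<in> ?G" and x: "gen \<omega> (Some {0, 1, 2}) \<in> ?G"
    by (intro incl; simp)+
  have "S \<in> Pow {0, 1, 2}" using Some assms(2) by (auto simp: letters_def)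
  then consider "S = {}" | "S = {0}" | "S = {1}" | "S = {2}" | "S = {0, 1}" | "S = {0, 2}"
    | "S = {1, 2}" | "S = {0, 1, 2}"
    by (auto simp: Pow_insert)
  then have "gen \<omega> (Some S) \<in> ?G"
  proof cases
    case 1
    show ?thesis by (rule xor_generate[OF x x]) (auto simp: 1)
  next
    case 2
    show ?thesis by (rule xor_generate[OF x d]) (auto simp: 2)
  next
    case 3
    show ?thesis by (rule xor_generate[OF x c]) (auto simp: 3)
  next
    case 4
    show ?thesis by (rule xor_generate[OF x b]) (auto simp: 4)
  qed (use b c d x in simp_all)
  then show ?thesis using Some by simp
qed

lemma carrier_overgroup:
  assumes "\<omega> \<in> Omega"
  shows "carrier (overgroup \<omega>) = act \<omega> ` lists letters"
proof -
  have "act \<omega> w \<in> generate Aut_T2 (generators \<omega>)" if "w \<in> lists letters" for w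
    using that
  proof (induction w)
    case Nil
    then show ?case using generate.one[of Aut_T2] by (simp add: one_Aut_T2 id_def)
  next
    case (Cons l w)
    then have "gen \<omega> l \<otimes>\<^bsub>Aut_T2\<^esub> act \<omega> w \<in> generate Aut_T2 (generators \<omega>)"
      by (intro generate.eng gen_in_generate[OF assms]) auto
    then show ?case by (simp add: mult_Aut_T2 gen_tree_automorphism act_tree_automorphism comp_def)
  qed
  then show ?thesis
    using generate_subset[OF assms] by (auto simp: overgroup_def)
qed

lemma mult_overgroup:
  assumes "\<omega> \<in> Omega" "f \<in> carrier (overgroup \<omega>)" "g \<in> carrier (overgroup \<omega>)"
  shows "f \<otimes>\<^bsub>overgroup \<omega>\<^esub> g = f \<circ> g"
  using assms(2,3) unfolding carrier_overgroup[OF assms(1)]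
  by (auto simp: overgroup_def mult_Aut_T2 act_tree_automorphism)

lemma one_overgroup: "\<one>\<^bsub>overgroup \<omega>\<^esub> = id"
  by (simp add: overgroup_def one_Aut_T2)

section \<open>Finite presentations and the transfer of relations\<close>

definition substitute :: "('s \<Rightarrow> nat set option list) \<Rightarrow> 's letter list \<Rightarrow> nat set option list" where
  "substitute u r = concat (map (\<lambda>(s, b). if b then u s else rev (u s)) r)"

lemma substitute_simps [simp]:
  "substitute u [] = []"
  "substitute u (l # r) = (if snd l then u (fst l) else rev (u (fst l))) @ substitute u r"
  by (auto simp: substitute_def split: prod.splits)

lemma act_substitute_reduced_Cons:
  "act \<omega> (substitute u (reduced_Cons l r)) = act \<omega> (substitute u [l]) \<circ> act \<omega> (substitute u r)"
proof (cases r)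
  case (Cons m r')
  have "act \<omega> (u s) \<circ> (act \<omega> (rev (u s)) \<circ> f) = f" "act \<omega> (rev (u s)) \<circ> (act \<omega> (u s) \<circ> f) = f"
    for s and f :: "vertex \<Rightarrow> vertex"
    by (simp_all only: comp_assoc[symmetric] act_rev_comp act_comp_rev id_comp)
  then show ?thesis
    using Cons by (auto simp: inv_letter_def comp_assoc)
qed simp

lemma act_substitute_foldr:
  "act \<omega> (substitute u (foldr reduced_Cons r r')) = act \<omega> (substitute u r) \<circ> act \<omega> (substitute u r')"
  by (induction r) (auto simp: fun_eq_iff act_substitute_reduced_Cons)

text \<open>One choice of \<open>u\<close> serves all sequences: the letters are involutions for
  each of them, so the reversed word always evaluates to the inverse.\<close>

lemma act_substitute_hom: "(\<lambda>r. act \<omega> (substitute u r)) \<in> hom (free_group S) Aut_T2"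
  by (auto simp: hom_def carrier_Aut_T2 act_tree_automorphism mult_Aut_T2 free_group_def
      act_substitute_foldr)

lemma act_substitute_normal_closure:
  assumes "R \<subseteq> carrier (free_group S)" "\<And>r. r \<in> R \<Longrightarrow> act \<omega> (substitute u r) = id"
    and "r \<in> normal_closure (free_group S) R"
  shows "act \<omega> (substitute u r) = id"
proof -
  have "group_hom (free_group S) Aut_T2 (\<lambda>r. act \<omega> (substitute u r))"
    by (intro group_hom.intro group_free_group group_Aut_T2 group_hom_axioms.intro act_substitute_hom)
  then have "kernel (free_group S) Aut_T2 (\<lambda>r. act \<omega> (substitute u r)) \<lhd> free_group S"
    by (rule group_hom.normal_kernel)
  then have "normal_closure (free_group S) R
      \<subseteq> kernel (free_group S) Aut_T2 (\<lambda>r. act \<omega> (substitute u r))"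
    using assms(1,2) by (intro normal_closure_minimal) (auto simp: kernel_def one_Aut_T2)
  then show ?thesis using assms(3) by (auto simp: kernel_def one_Aut_T2)
qed

text \<open>The quotient map followed by the isomorphism; in this form the abstract generators can
  be replaced by words.\<close>

lemma finitely_presented_hom:
  assumes "finitely_presented G" "group G"
  shows "\<exists>(S :: nat set) R h. finite R \<and> R \<subseteq> carrier (free_group S) \<and>
    h \<in> hom (free_group S) G \<and> h ` carrier (free_group S) = carrier G \<and>
    (\<forall>r \<in> carrier (free_group S). h r = \<one>\<^bsub>G\<^esub> \<longleftrightarrow> r \<in> normal_closure (free_group S) R)"
proof -
  obtain S :: "nat set" and R where SR: "finite R" "R \<subseteq> carrier (free_group S)"
      "G \<cong> free_group S Mod normal_closure (free_group S) R"
    using assms(1) unfolding finitely_presented_def by blast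
  let ?F = "free_group S" and ?N = "normal_closure (free_group S) R"
  interpret F: group ?F by (rule group_free_group)
  interpret N: normal ?N ?F by (rule F.normal_closure_normal[OF SR(2)])
  interpret Q: group "?F Mod ?N" by (rule N.factorgroup_is_group)
  interpret G: group G by fact
  have "?F Mod ?N \<cong> G" using SR(3) by (rule G.iso_sym)
  then obtain \<psi> where \<psi>: "\<psi> \<in> hom (?F Mod ?N) G" "bij_betw \<psi> (carrier (?F Mod ?N)) (carrier G)"
    by (auto simp: is_iso_def iso_def)
  let ?\<pi> = "\<lambda>r. ?N #>\<^bsub>?F\<^esub> r"
  have \<pi>: "?\<pi> \<in> hom ?F (?F Mod ?N)" by (rule N.r_coset_hom_Mod)
  have im: "?\<pi> ` carrier ?F = carrier (?F Mod ?N)"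
    by (auto simp: FactGroup_def RCOSETS_def)
  have "\<psi> \<circ> ?\<pi> \<in> hom ?F G"
    using \<pi> \<psi>(1) by (rule hom_compose)
  moreover have "(\<psi> \<circ> ?\<pi>) ` carrier ?F = carrier G"
    unfolding image_comp[symmetric] im using \<psi>(2) by (simp add: bij_betw_def)
  moreover have "(\<psi> \<circ> ?\<pi>) r = \<one>\<^bsub>G\<^esub> \<longleftrightarrow> r \<in> ?N" if r: "r \<in> carrier ?F" for r
  proof -
    have "\<psi> (?\<pi> r) = \<one>\<^bsub>G\<^esub> \<longleftrightarrow> ?\<pi> r = \<one>\<^bsub>?F Mod ?N\<^esub>"
      using \<psi> r im hom_one[OF \<psi>(1) Q.is_group G.is_group] Q.one_closed
      by (metis bij_betw_def imageI inj_onD)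
    also have "\<dots> \<longleftrightarrow> r \<in> ?N"
      using r by (metis F.coset_join1 F.coset_join2 N.is_subgroup N.subset one_FactGroup)
    finally show ?thesis by simp
  qed
  ultimately show ?thesis using SR(1,2) by blast
qed

lemma act_substitute_eq_hom:
  assumes "\<omega> \<in> Omega" "h \<in> hom (free_group S) (overgroup \<omega>)"
    and "\<And>s. s \<in> S \<Longrightarrow> act \<omega> (u s) = h [(s, True)]"
    and "r \<in> carrier (free_group S)"
  shows "h r = act \<omega> (substitute u r)"
proof -
  let ?F = "free_group S"
  interpret h: group_hom ?F "overgroup \<omega>" h
    by (intro group_hom.intro group_free_group group_overgroup group_hom_axioms.intro assms(2))
  have mult: "h (v \<otimes>\<^bsub>?F\<^esub> w) = h v \<circ> h w" if "v \<in> carrier ?F" "w \<in> carrier ?F" for v w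
    using that h.hom_mult mult_overgroup[OF assms(1)] h.hom_closed by simp
  have single: "[(s, b)] \<in> carrier ?F" if "s \<in> S" for s b
    using that by (simp add: free_group_def reduced_def)
  have letter: "h [(s, b)] = act \<omega> (substitute u [(s, b)])" if s: "s \<in> S" for s b
  proof (cases b)
    case True
    then show ?thesis using assms(3)[OF s] by simp
  next
    case False
    have "h [(s, False)] \<circ> h [(s, True)] = h ([(s, False)] \<otimes>\<^bsub>?F\<^esub> [(s, True)])"
      using mult single s by simp
    also have "[(s, False)] \<otimes>\<^bsub>?F\<^esub> [(s, True)] = \<one>\<^bsub>?F\<^esub>"
      by (simp add: free_group_def inv_letter_def)
    finally have "h [(s, False)] \<circ> act \<omega> (u s) = id"
      unfolding h.hom_one one_overgroup assms(3)[OF s] .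
    then have "h [(s, False)] \<circ> (act \<omega> (u s) \<circ> act \<omega> (rev (u s))) = act \<omega> (rev (u s))"
      by (simp only: comp_assoc[symmetric] id_comp)
    then show ?thesis using False by (simp only: act_comp_rev comp_id) simp
  qed
  show ?thesis
    using assms(4)
  proof (induction r)
    case Nil
    have "h [] = id" using h.hom_one unfolding one_overgroup by (simp add: free_group_def)
    then show ?case by simp
  next
    case (Cons l r)
    obtain s b where l: "l = (s, b)" by force
    have r: "r \<in> carrier ?F" and s: "s \<in> S"
      using Cons.prems l by (auto simp: free_group_def dest: reduced_ConsD)
    \<comment> \<open>Since \<open>l # r\<close> is reduced, no cancellation takes place and
      prepending \<open>l\<close> is multiplication in the free group.\<close>
    have "reduced_Cons l r = l # r"
      using Cons.prems by (cases r) (auto simp: free_group_def reduced_def)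
    then have "[l] \<otimes>\<^bsub>?F\<^esub> r = l # r" by (simp add: free_group_def)
    then have "h (l # r) = h [l] \<circ> h r"
      using mult[of "[l]" r] r single[OF s] l by simp
    then show ?case using Cons.IH[OF r] letter[OF s] l by simp
  qed
qed

lemma finitely_presented_stable:
  assumes "\<omega> \<in> Omega" "\<And>e k. e \<in> E \<Longrightarrow> \<exists>j\<ge>k. \<omega> j = e"
    and "finitely_presented (overgroup \<omega>)"
  shows "\<exists>n. \<forall>\<omega>'. close E n \<omega> \<omega>' \<longrightarrow>
    (\<forall>w \<in> lists letters. act \<omega> w = id \<longrightarrow> act \<omega>' w = id)"
proof -
  obtain S :: "nat set" and R h where R: "finite R" "R \<subseteq> carrier (free_group S)"
    and h: "h \<in> hom (free_group S) (overgroup \<omega>)"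
      "h ` carrier (free_group S) = carrier (overgroup \<omega>)"
    and ker: "\<forall>r \<in> carrier (free_group S).
      h r = \<one>\<^bsub>overgroup \<omega>\<^esub> \<longleftrightarrow> r \<in> normal_closure (free_group S) R"
    using finitely_presented_hom[OF assms(3) group_overgroup] by blast
  let ?F = "free_group S"
  have "\<exists>w. act \<omega> w = h [(s, True)]" if "s \<in> S" for s
  proof -
    have "[(s, True)] \<in> carrier ?F" using that by (simp add: free_group_def reduced_def)
    then have "h [(s, True)] \<in> act \<omega> ` lists letters"
      using h(2) carrier_overgroup[OF assms(1)] by blast
    then show ?thesis by force
  qed
  then obtain u where u: "\<And>s. s \<in> S \<Longrightarrow> act \<omega> (u s) = h [(s, True)]"
    by metis
  have h_eq: "h r = act \<omega> (substitute u r)" if "r \<in> carrier ?F" for r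
    by (rule act_substitute_eq_hom[OF assms(1) h(1) u that])
  have "\<exists>z. z \<in> carrier ?F \<and> h z = gen \<omega> l" if "l \<in> letters" for l
  proof -
    have "act \<omega> [l] \<in> act \<omega> ` lists letters" using that by (intro imageI) simp
    then have "gen \<omega> l \<in> h ` carrier ?F"
      using h(2) carrier_overgroup[OF assms(1)] by simp
    then show ?thesis by force
  qed
  then obtain z where z: "\<And>l. l \<in> letters \<Longrightarrow> z l \<in> carrier ?F"
      "\<And>l. l \<in> letters \<Longrightarrow> h (z l) = gen \<omega> l"
    by metis
  \<comment> \<open>The relators, rewritten as words, do not suffice: for another sequence it must
    also be known that the chosen preimage \<open>z l\<close> still represents the letter
    \<open>l\<close>. As \<open>l\<close> is an involution, this is the relation
    \<open>substitute u (z l) @ [l]\<close>.\<close>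
  define Q where "Q = substitute u ` R \<union> (\<lambda>l. substitute u (z l) @ [l]) ` letters"
  have "act \<omega> q = id" if q: "q \<in> Q" for q
  proof -
    consider r where "r \<in> R" "q = substitute u r" | l where "l \<in> letters" "q = substitute u (z l) @ [l]"
      using q unfolding Q_def by blast
    then show ?thesis
    proof cases
      case 1
      then have "r \<in> carrier ?F" "r \<in> normal_closure ?F R"
        using R(2) subset_normal_closure[of R] by blast+
      then show ?thesis using 1 ker h_eq by (simp add: one_overgroup)
    next
      case 2
      then have "act \<omega> (substitute u (z l)) = gen \<omega> l"
        using h_eq[OF z(1)] z(2) by simp
      then show ?thesis using 2 by (auto simp: fun_eq_iff)
    qed
  qed
  then have "\<exists>n. \<forall>\<omega>'. close E n \<omega> \<omega>' \<longrightarrow> act \<omega>' q = id" if "q \<in> Q" for q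
    using that assms(2) by (intro relation_stable)
  then obtain n where n: "\<And>q \<omega>'. q \<in> Q \<Longrightarrow> close E (n q) \<omega> \<omega>' \<Longrightarrow> act \<omega>' q = id"
    by metis
  have "finite Q" using R(1) finite_letters by (simp add: Q_def)
  show ?thesis
  proof (intro exI allI impI ballI)
    fix \<omega>' w assume c: "close E (Max (n ` Q)) \<omega> \<omega>'"
      and w: "w \<in> lists letters" "act \<omega> w = id"
    have Q: "act \<omega>' q = id" if "q \<in> Q" for q
      using n[OF that] close_mono[OF c] that \<open>finite Q\<close> by simp
    have gen: "act \<omega>' (substitute u (z l)) = gen \<omega>' l" if "l \<in> letters" for l
    proof
      fix v
      have "act \<omega>' (substitute u (z l) @ [l]) = id"
        using that by (intro Q) (simp add: Q_def)
      then have "act \<omega>' (substitute u (z l) @ [l]) (gen \<omega>' l v) = gen \<omega>' l v"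
        by simp
      then show "act \<omega>' (substitute u (z l)) v = gen \<omega>' l v" by simp
    qed
    \<comment> \<open>An element of the free group that represents \<open>w\<close> for both
      sequences. Triviality for \<open>\<omega>\<close> puts it into the normal closure, and the
      relators carry this over to \<open>\<omega>'\<close>.\<close>
    define r where "r = foldr (\<lambda>l r. foldr reduced_Cons (z l) r) w []"
    have "r \<in> carrier ?F \<and> h r = act \<omega> w \<and> act \<omega>' (substitute u r) = act \<omega>' w"
      using w(1) unfolding r_def
    proof (induction w)
      case Nil
      have "[] \<in> carrier ?F" by (simp add: free_group_def)
      then show ?case using h_eq by simp
    next
      case (Cons l w)
      let ?r = "foldr (\<lambda>l r. foldr reduced_Cons (z l) r) w []"
      have l: "l \<in> letters" and IH: "?r \<in> carrier ?F" "h ?r = act \<omega> w" "act \<omega>' (substitute u ?r) = act \<omega>' w"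
        using Cons by auto
      have "z l \<otimes>\<^bsub>?F\<^esub> ?r \<in> carrier ?F"
        using z(1)[OF l] IH(1) by (intro monoid.m_closed[OF group.is_monoid[OF group_free_group]])
      then have car: "foldr reduced_Cons (z l) ?r \<in> carrier ?F"
        by (simp add: free_group_def)
      then show ?case
        using IH h_eq[OF car] h_eq[OF z(1)[OF l]] h_eq[OF IH(1)] z(2)[OF l] gen[OF l]
        by (simp add: act_substitute_foldr)
    qed
    then have "r \<in> normal_closure ?F R" "act \<omega>' (substitute u r) = act \<omega>' w"
      using w(2) ker by (auto simp: one_overgroup)
    then show "act \<omega>' w = id"
      using act_substitute_normal_closure[OF R(2), of \<omega>' u r] Q by (auto simp: Q_def)
  qed
qed

section \<open>Two recurring symbols and the final contradiction\<close>

lemma infinitely_often_two_values: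
  assumes "\<omega> \<in> Omega - Omega2"
  obtains s t where "s \<noteq> t" "s \<in> {0, 1, 2}" "t \<in> {0, 1, 2}"
    "\<And>k. \<exists>j\<ge>k. \<omega> j = s" "\<And>k. \<exists>j\<ge>k. \<omega> j = t"
proof -
  have fin: "\<omega> k \<in> {0, 1, 2}" for k using assms by (auto simp: Omega_def)
  have nc: "\<not> (\<forall>n\<ge>N. \<omega> n = c)" for N c using assms by (auto simp: Omega2_def)
  \<comment> \<open>Pigeonhole for a finite set of symbols that is hit again and again. It is
    applied first to all symbols, then to those other than \<open>s\<close>, which recur because the
    sequence is not eventually constant.\<close>
  have "\<exists>s\<in>A. \<forall>k. \<exists>j\<ge>k. \<omega> j = s"
    if A: "\<And>k. \<exists>j\<ge>k. \<omega> j \<in> A" "A \<subseteq> {0, 1, 2}" for A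
  proof (rule ccontr)
    assume "\<not> ?thesis"
    then obtain k where k: "\<And>s j. s \<in> A \<Longrightarrow> k s \<le> j \<Longrightarrow> \<omega> j \<noteq> s" by metis
    have "finite A" using A(2) finite_subset by blast
    obtain j where j: "j \<ge> Max (insert 0 (k ` A))" "\<omega> j \<in> A" using A(1) by blast
    have "k (\<omega> j) \<le> j" using j \<open>finite A\<close> by simp
    then show False using k[OF j(2)] by blast
  qed note * = this
  obtain s where s: "s \<in> {0, 1, 2}" "\<And>k. \<exists>j\<ge>k. \<omega> j = s"
    using *[of "{0, 1, 2}"] fin by blast
  obtain t where t: "t \<in> {0, 1, 2} - {s}" "\<And>k. \<exists>j\<ge>k. \<omega> j = t"
  proof -
    have "\<exists>j\<ge>k. \<omega> j \<in> {0, 1, 2} - {s}" for k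
      using nc[of k s] fin by blast
    then show thesis using *[of "{0, 1, 2} - {s}"] that by blast
  qed
  show thesis using that[of s t] s t by blast
qed

lemma funpow_shift: "(shift ^^ m) \<omega> k = \<omega> (m + k)"
  by (induction m arbitrary: k) (auto simp: shift_def)

lemma lift_word_in_lists:
  assumes "w \<in> lists A" "None \<in> A" "Some {0, 1, 2} \<in> A"
  shows "lift_word w \<in> lists A"
  using assms(1)
proof (induction w)
  case (Cons l w)
  then show ?case using assms(2,3) by (cases l) (simp_all del: One_nat_def)
qed simp

lemma funpow_lift_word_in_lists:
  assumes "w \<in> lists A" "None \<in> A" "Some {0, 1, 2} \<in> A"
  shows "(lift_word ^^ m) w \<in> lists A"
  by (induction m) (simp_all only: funpow.simps id_apply o_apply assms lift_word_in_lists)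

lemma comm_power_in_lists:
  assumes "g \<in> lists A" "Some {s} \<in> A" "Some {t} \<in> A"
  shows "comm_power N s t g \<in> lists A"
proof -
  have "concat (replicate N w) \<in> lists A" if "w \<in> lists A" for w
    using that by (induction N) simp_all
  moreover have "rev g \<in> lists A" using assms(1) by (simp add: in_lists_conv_set)
  ultimately show ?thesis using assms by (simp add: comm_power_def Let_def)
qed

theorem corollary2:
  fixes \<omega> :: "nat \<Rightarrow> nat"
  assumes "\<omega> \<in> Omega - Omega2"
  shows "\<not> finitely_presented (overgroup \<omega>)"
proof
  assume fp: "finitely_presented (overgroup \<omega>)"
  have \<omega>: "\<omega> \<in> Omega" using assms by simp
  obtain s t where st: "s \<noteq> t" "s \<in> {0, 1, 2}" "t \<in> {0, 1, 2}"
    and inf: "\<And>k. \<exists>j\<ge>k. \<omega> j = s" "\<And>k. \<exists>j\<ge>k. \<omega> j = t"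
    by (rule infinitely_often_two_values[OF assms]) blast
  have "\<exists>j\<ge>k. \<omega> j = e" if "e \<in> {s, t}" for e k using inf that by blast
  then have "\<exists>n. \<forall>\<omega>'. close {s, t} n \<omega> \<omega>' \<longrightarrow>
      (\<forall>w \<in> lists letters. act \<omega> w = id \<longrightarrow> act \<omega>' w = id)"
    by (rule finitely_presented_stable[OF \<omega> _ fp])
  then obtain n where n: "\<forall>\<omega>'. close {s, t} n \<omega> \<omega>' \<longrightarrow>
      (\<forall>w \<in> lists letters. act \<omega> w = id \<longrightarrow> act \<omega>' w = id)" ..
  \<comment> \<open>The prefix is stretched until the next symbol is \<open>s\<close>, as
    \<open>act_comm_power_a\<close> requires.\<close>
  obtain m where m: "m \<ge> n" "\<omega> m = s" using inf(1) by blast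
  define \<tau> where "\<tau> = (shift ^^ m) \<omega>"
  \<comment> \<open>The symbol \<open>s\<close> at position \<open>m\<close> is kept and
    \<open>t\<close> follows forever, so behind it the product has infinite order for
    \<open>\<omega>'\<close>.\<close>
  define \<omega>' where "\<omega>' k = (if k \<le> m then \<omega> k else t)" for k
  define \<tau>' where "\<tau>' = (shift ^^ m) \<omega>'"
  have \<omega>': "\<omega>' \<in> Omega" using \<omega> st by (auto simp: Omega_def \<omega>'_def)
  have \<tau>0: "\<tau> 0 = s" "\<tau>' 0 = s"
    using m by (simp_all add: \<tau>_def \<tau>'_def funpow_shift \<omega>'_def)
  have const: "shift \<tau>' = (\<lambda>_. t)"
    by (auto simp: shift_def \<tau>'_def funpow_shift \<omega>'_def)
  \<comment> \<open>A later \<open>s\<close> in \<open>\<omega>\<close> makes the same product have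
    finite order there, which provides the exponent \<open>N\<close>.\<close>
  obtain j where j: "j \<ge> Suc m" "\<omega> j = s" using inf(1) by blast
  have "shift \<tau> (j - Suc m) \<noteq> t"
    using j st(1) by (simp add: shift_def \<tau>_def funpow_shift)
  then obtain N where N: "N > 0" "act (shift \<tau>) (dih t N) = id"
    using dih_finite_order by blast
  have "act (shift \<tau>) (dih t (2 * N)) = id"
    using N(2) by (simp add: mult_2 dih_add)
  define w where "w = comm_power N s t ((lift_word ^^ m) [None])"
  have "act \<omega> w = id"
    using \<open>act (shift \<tau>) (dih t (2 * N)) = id\<close>
    unfolding w_def act_lift_comm_power_funpow[OF st(1) \<omega>] \<tau>_def[symmetric]
      act_comm_power_a[of s t \<tau>, OF st(1) \<tau>0(1)] .
  moreover have "close {s, t} n \<omega> \<omega>'"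
    using m by (auto simp: close_def \<omega>'_def)
  moreover have "w \<in> lists letters"
  proof -
    have "{None, Some {s}, Some {t}, Some {0, 1, 2}} \<subseteq> letters"
      using st(2,3) unfolding letters_def by blast
    then have "None \<in> letters" "Some {s} \<in> letters" "Some {t} \<in> letters"
        "Some {0, 1, 2} \<in> letters"
      by simp_all
    then show ?thesis
      unfolding w_def by (intro comm_power_in_lists funpow_lift_word_in_lists) simp_all
  qed
  ultimately have "act \<omega>' w = id" using n by blast
  then have "act (shift \<tau>') (dih t (2 * N)) = id"
    unfolding w_def act_lift_comm_power_funpow[OF st(1) \<omega>'] \<tau>'_def[symmetric]
      act_comm_power_a[of s t \<tau>', OF st(1) \<tau>0(2)] .
  then show False using dih_infinite_order[of t "2 * N"] const N(1) by simp
qed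

end
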